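(* Let $Q$ be a connected quiver. The following statements are equivalent. (1) The quiver $Q$ is locally finite and there are only finitely many sectional paths between any two vertices of $\mathbb{Z}Q$. (2) There are only finitely many (possibly non-sectional) paths between any two vertices in $\mathbb{Z}Q$. (3) For every vertex $x\in\mathbb{Z}Q$ there are only finitely many paths from $x$ to $\tau^{-n}x$ in $\mathbb{Z}Q$ for all $n\in\mathbb{N}$. (4) There is a vertex $x\in\mathbb{Z}Q$ such that there are only finitely many paths from $x$ to $\tau^{-n}x$ in $\mathbb{Z}Q$ for all $n\in\mathbb{N}$. (5) The quiver $Q$ is without oriented cycles, and for all $x\in Q$ and $n\in\mathbb{N}$ the round trip distance sphere $S_Q(x,n)$ is finite. (6) The quiver $Q$ is without oriented cycles, and there is an $x\in Q$ such that the round trip distance sphere $S_Q(x,n)$ is finite for all $n\in\mathbb{N}$. (7) The translation quiver $\mathbb{Z}Q$ has a strongly locally finite section.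
   Context: $\mathbb{N}=\{0,1,2,\dots\}$. A quiver consists of a set of vertices and a set of arrows (possibly infinite; loops and multiple arrows allowed); $x\in Q$ means $x$ is a vertex. A connected quiver is nonempty. A path from $x$ to $y$ is a sequence of vertices $x=x_0,\dots,x_m=y$ ($m\ge0$) with an arrow $x_i\to x_{i+1}$ for all $i<m$; it is trivial if $m=0$. An oriented cycle is a nontrivial path from a vertex to itself. A quiver is locally finite if every vertex has only finitely many neighbors (vertices joined to it by an arrow in some direction). In an unoriented path each step traverses an arrow either in its direction or in the opposite direction. The stable translation quiver $\mathbb{Z}Q$ has vertices $(n,x)$, $n\in\mathbb{Z}$, $x\in Q$; the number of arrows $(i,x)\to(j,y)$ equals the number of arrows $x\to y$ in $Q$ if $i=j$, the number of arrows $y\to x$ in $Q$ if $j=i+1$, and zero otherwise. The translation is $\tau(n,x)=(n-1,x)$. A sectional path in $\mathbb{Z}Q$ is a path $A_0\to A_1\to\cdots\to A_m$ with $A_i\ne\tau A_{i+2}$ for all $i\in\{0,\dots,m-2\}$. A section of $\mathbb{Z}Q$ is a full subquiver $Q'$ such that the embedding $Q'\to\mathbb{Z}Q$ extends (along $Q'\to\mathbb{Z}Q'$, $x\mapsto(0,x)$) to an isomorphism $\mathbb{Z}Q'\to\mathbb{Z}Q$ of quivers commuting with the translations. The round trip distance $d_Q(x,y)$ of vertices $x,y\in Q$ is the least number of arrows traversed in the opposite direction on an unoriented path from $x$ to itself passing through $y$; $S_Q(x,n)=\{y\in Q\mid d_Q(x,y)=n\}$. A quiver is strongly locally finite if it is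 connected, locally finite, and path finite, i.e. there are no infinite sequences $a_0\to a_1\to a_2\to\cdots$ or $\cdots\to a_2\to a_1\to a_0$ of consecutive arrows (vertices need not be distinct; in particular there are no oriented cycles). *)

theory Defs
  imports "Graph_Theory.Vertex_Walk" "Graph_Theory.Digraph_Isomorphism"
begin

text \<open>
  A quiver is a \<^const>\<open>wf_digraph\<close>: vertices and arrows may be infinite in number, and loops and
  multiple arrows are allowed. Paths are sequences of vertices, hence \<^const>\<open>vwalk\<close>s: replacing
  an arrow of a path by a parallel one does not give a new path.
\<close>

definition paths :: "('v, 'e) pre_digraph \<Rightarrow> 'v \<Rightarrow> 'v \<Rightarrow> 'v list set" where
  "paths Q x y = {p. vwalk p Q \<and> hd p = x \<and> last p = y}"

definition oriented_cycle :: "('v, 'e) pre_digraph \<Rightarrow> 'v list \<Rightarrow> bool" where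
  "oriented_cycle Q p \<longleftrightarrow> (\<exists>x \<in> verts Q. p \<in> paths Q x x) \<and> vwalk_length p > 0"

definition locally_finite :: "('v, 'e) pre_digraph \<Rightarrow> bool" where
  "locally_finite Q \<longleftrightarrow> (\<forall>x \<in> verts Q. finite {y. x \<rightarrow>\<^bsub>Q\<^esub> y \<or> y \<rightarrow>\<^bsub>Q\<^esub> x})"

definition path_finite :: "('v, 'e) pre_digraph \<Rightarrow> bool" where
  "path_finite Q \<longleftrightarrow>
     \<not> (\<exists>a :: nat \<Rightarrow> 'v. \<forall>i. a i \<rightarrow>\<^bsub>Q\<^esub> a (Suc i)) \<and>
     \<not> (\<exists>a :: nat \<Rightarrow> 'v. \<forall>i. a (Suc i) \<rightarrow>\<^bsub>Q\<^esub> a i)"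

definition strongly_locally_finite :: "('v, 'e) pre_digraph \<Rightarrow> bool" where
  "strongly_locally_finite Q \<longleftrightarrow> connected Q \<and> locally_finite Q \<and> path_finite Q"


section \<open>The stable translation quiver\<close>

text \<open>
  An arrow \<open>a : x \<rightarrow> y\<close> of \<open>Q\<close> gives, for every integer \<open>i\<close>, the arrows
  \<open>Level i a : (i, x) \<rightarrow> (i, y)\<close> and \<open>Shift i a : (i, y) \<rightarrow> (i + 1, x)\<close>.
\<close>

datatype 'e zarrow = Level int 'e | Shift int 'e

primrec ztail :: "('v, 'e) pre_digraph \<Rightarrow> 'e zarrow \<Rightarrow> int \<times> 'v" where
  "ztail Q (Level i a) = (i, tail Q a)"
| "ztail Q (Shift i a) = (i, head Q a)"

primrec zhead :: "('v, 'e) pre_digraph \<Rightarrow> 'e zarrow \<Rightarrow> int \<times> 'v" where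
  "zhead Q (Level i a) = (i, head Q a)"
| "zhead Q (Shift i a) = (i + 1, tail Q a)"

definition ZQ :: "('v, 'e) pre_digraph \<Rightarrow> (int \<times> 'v, 'e zarrow) pre_digraph" where
  "ZQ Q = \<lparr>verts = UNIV \<times> verts Q,
           arcs = {Level i a | i a. a \<in> arcs Q} \<union> {Shift i a | i a. a \<in> arcs Q},
           tail = ztail Q, head = zhead Q\<rparr>"

lemma wf_digraph_ZQ: "wf_digraph Q \<Longrightarrow> wf_digraph (ZQ Q)"
  by (auto simp: wf_digraph_def ZQ_def)

definition \<tau> :: "int \<times> 'v \<Rightarrow> int \<times> 'v" where
  "\<tau> = (\<lambda>(n, x). (n - 1, x))"

lemma bij_\<tau>: "bij \<tau>"
  by (rule bij_betw_byWitness[where f' = "\<lambda>(n, x). (n + 1, x)"]) (auto simp: \<tau>_def)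

definition sectional_paths ::
    "('v, 'e) pre_digraph \<Rightarrow> int \<times> 'v \<Rightarrow> int \<times> 'v \<Rightarrow> (int \<times> 'v) list set" where
  "sectional_paths Q x y =
     {p \<in> paths (ZQ Q) x y. \<forall>i. i + 2 < length p \<longrightarrow> p ! i \<noteq> \<tau> (p ! (i + 2))}"

text \<open>
  The equation \<open>app_iso h (ZQ S) = ZQ Q\<close> contains surjectivity of \<open>h\<close> and, as the components
  \<open>iso_tail h\<close> and \<open>iso_head h\<close> are thereby the incidence functions of \<open>ZQ Q\<close>, compatibility with
  tails and heads.
\<close>

definition is_section ::
    "(int \<times> 'v, 'e zarrow) pre_digraph \<Rightarrow> ('v, 'e) pre_digraph \<Rightarrow> bool" where
  "is_section S Q \<longleftrightarrow> induced_subgraph S (ZQ Q) \<and>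
     (\<exists>h. pre_digraph.digraph_isomorphism (ZQ S) h \<and> app_iso h (ZQ S) = ZQ Q \<and>
        (\<forall>x \<in> verts S. iso_verts h (0, x) = x) \<and>
        (\<forall>a \<in> arcs S. iso_arcs h (Level 0 a) = a) \<and>
        (\<forall>z \<in> verts (ZQ S). iso_verts h (\<tau> z) = \<tau> (iso_verts h z)))"


section \<open>Round trip distance\<close>

text \<open>
  Unoriented paths in \<open>Q\<close> are the arc walks in the quiver obtained by adding to each arrow its
  reverse.
\<close>

datatype 'e step = is_Fwd: Fwd 'e | is_Bwd: Bwd 'e

primrec step_tail :: "('v, 'e) pre_digraph \<Rightarrow> 'e step \<Rightarrow> 'v" where
  "step_tail Q (Fwd a) = tail Q a"
| "step_tail Q (Bwd a) = head Q a"

primrec step_head :: "('v, 'e) pre_digraph \<Rightarrow> 'e step \<Rightarrow> 'v" where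
  "step_head Q (Fwd a) = head Q a"
| "step_head Q (Bwd a) = tail Q a"

definition double_quiver :: "('v, 'e) pre_digraph \<Rightarrow> ('v, 'e step) pre_digraph" where
  "double_quiver Q = \<lparr>verts = verts Q, arcs = Fwd ` arcs Q \<union> Bwd ` arcs Q,
                      tail = step_tail Q, head = step_head Q\<rparr>"

definition round_trips :: "('v, 'e) pre_digraph \<Rightarrow> 'v \<Rightarrow> 'v \<Rightarrow> 'e step list set" where
  "round_trips Q x y = {p. pre_digraph.awalk (double_quiver Q) x p x \<and>
                           y \<in> set (pre_digraph.awalk_verts (double_quiver Q) x p)}"

text \<open>For vertices \<open>x\<close>, \<open>y\<close> of a connected quiver the set of round trips is nonempty.\<close>

definition round_trip_distance :: "('v, 'e) pre_digraph \<Rightarrow> 'v \<Rightarrow> 'v \<Rightarrow> nat" where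
  "round_trip_distance Q x y = (LEAST n. \<exists>p \<in> round_trips Q x y. n = length (filter is_Bwd p))"

definition round_trip_sphere :: "('v, 'e) pre_digraph \<Rightarrow> 'v \<Rightarrow> nat \<Rightarrow> 'v set" where
  "round_trip_sphere Q x n = {y \<in> verts Q. round_trip_distance Q x y = n}"

end

theory Submission
  imports Defs
begin

text \<open>
  A path in \<open>ZQ Q\<close> from \<open>(i, x)\<close> to \<open>(j, y)\<close> is an unoriented path in \<open>Q\<close> from \<open>x\<close> to \<open>y\<close> with
  \<open>j - i\<close> backward steps (\<open>awalk_lifts_to_ZQ\<close>, \<open>paths_ZQ_project\<close>). In particular, \<open>y\<close> lies in the
  sphere of radius \<open>n\<close> around \<open>x\<close> iff \<open>n\<close> is minimal such that some path from \<open>(0, x)\<close> to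
  \<open>(n, x)\<close> visits a copy of \<open>y\<close>. All conditions are compared with (2), finiteness of all sets
  of paths.

  \<^item> (2), (3), (4): as \<open>Q\<close> is connected, any two vertices of \<open>ZQ Q\<close> with a path between them lie
    between two translates of any given vertex (\<open>finite_paths_ZQ_of_base\<close>).

  \<^item> (5), (6): a sphere is covered by finitely many paths, and finite sets of paths exclude cycles.
    Conversely, in the absence of cycles the paths from \<open>x\<close> to its inverse translates are lists of
    distinct vertices in a finite set that is made up of spheres
    (\<open>finite_spheres_imp_finite_paths\<close>), which gives (4).

  \<^item> (1): two neighboring vertices lie on a path of length two between a vertex and its inverse
    translate, which gives local finiteness. Conversely, a path becomes sectional by cutting out
    pieces \<open>\<tau> c \<rightarrow> b \<rightarrow> c\<close>; each of them costs one level, so a long path leaves a long sectional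
    path (\<open>path_reduces_to_sectional_path\<close>).

  \<^item> (7): for a strongly locally finite \<open>S\<close>, paths in \<open>ZQ S\<close> are counted by well-founded induction
    (\<open>path_finite_imp_finite_paths_ZQ\<close>), and an isomorphism carries the result to \<open>ZQ Q\<close>.
    Conversely, fix \<open>x\<close> and put each vertex \<open>y\<close> on the level half way between the last predecessor
    and the first successor of \<open>(0, x)\<close> among the copies of \<open>y\<close>. This is a section, and an
    infinite path in it would have bounded round trip distance from \<open>x\<close>, hence would run inside a
    finite set and produce a cycle (\<open>middle_slice_path_finite\<close>).
\<close>

\<comment> \<open>The function space arrow would compete with the arrow of adjacency.\<close>
unbundle no funcset_syntax


section \<open>Paths in quivers\<close>

lemma paths_Nil [simp]: "[] \<notin> paths G u v"
  by (simp add: paths_def vwalk_def)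

lemma (in wf_digraph) paths_Cons:
  "a # p \<in> paths G u v \<longleftrightarrow>
     a = u \<and> u \<in> verts G \<and> (p = [] \<and> u = v \<or> (\<exists>w. u \<rightarrow> w \<and> p \<in> paths G w v))"
proof (cases p)
  case Nil
  then show ?thesis by (auto simp: paths_def vwalk_def)
next
  case (Cons b q)
  then show ?thesis
    by (auto simp: paths_def vwalk_def dest: adj_in_verts)
qed

lemma (in wf_digraph) paths_ConsI:
  "u \<rightarrow> w \<Longrightarrow> p \<in> paths G w v \<Longrightarrow> u # p \<in> paths G u v"
  by (auto simp: paths_Cons adj_in_verts)

lemma (in wf_digraph) paths_hd_last:
  assumes "p \<in> paths G u v"
  shows "p \<noteq> []" "hd p = u" "last p = v" "u \<in> set p" "v \<in> set p" "set p \<subseteq> verts G"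
        "u \<in> verts G" "v \<in> verts G"
  using assms by (auto simp: paths_def vwalk_def)

text \<open>
  Splitting a path at one of its vertices. As a rewrite rule this loops, because the right-hand side
  contains an instance of the left-hand side.
\<close>

lemma (in wf_digraph) paths_append_Cons:
  "p @ w # q \<in> paths G u v \<longleftrightarrow> p @ [w] \<in> paths G u w \<and> w # q \<in> paths G w v"
proof (induction p arbitrary: u)
  case Nil
  then show ?case by (auto simp: paths_Cons)
next
  case (Cons a p)
  have "p @ w # q \<in> paths G x v \<longleftrightarrow> p @ [w] \<in> paths G x w \<and> w # q \<in> paths G w v" for x
    by (rule Cons.IH)
  then show ?case by (auto simp: paths_Cons)
qed

lemma (in wf_digraph) paths_join:
  assumes "p \<in> paths G u w" "q \<in> paths G w v"
  shows "butlast p @ q \<in> paths G u v"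
proof -
  have "p = butlast p @ [w]" using paths_hd_last[OF assms(1)] by (metis append_butlast_last_id)
  moreover have "q = w # tl q" using paths_hd_last[OF assms(2)] by (metis list.collapse)
  ultimately show ?thesis using assms paths_append_Cons by metis
qed

lemma (in wf_digraph) reachable_iff_paths: "u \<rightarrow>\<^sup>* v \<longleftrightarrow> paths G u v \<noteq> {}"
proof
  assume "u \<rightarrow>\<^sup>* v"
  then show "paths G u v \<noteq> {}"
  proof (induction rule: converse_reachable_induct)
    case base
    then have "[v] \<in> paths G v v" by (simp add: paths_Cons)
    then show ?case by blast
  next
    case (step x y)
    then obtain p where "p \<in> paths G y v" by blast
    with step have "x # p \<in> paths G x v" by (auto simp: paths_Cons adj_in_verts)
    then show ?case by blast
  qed
next
  have "p \<in> paths G u v \<Longrightarrow> u \<rightarrow>\<^sup>* v" for p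
    by (induction p arbitrary: u) (auto simp: paths_Cons intro: adj_reachable_trans)
  then show "paths G u v \<noteq> {} \<Longrightarrow> u \<rightarrow>\<^sup>* v" by blast
qed

lemma (in wf_digraph) path_through:
  assumes "u \<rightarrow>\<^sup>* w" "w \<rightarrow>\<^sup>* v"
  shows "\<exists>p \<in> paths G u v. w \<in> set p"
proof -
  obtain p q where p: "p \<in> paths G u w" and q: "q \<in> paths G w v"
    using assms unfolding reachable_iff_paths by blast
  then have "butlast p @ q \<in> paths G u v" "w \<in> set (butlast p @ q)"
    using paths_join[OF p q] paths_hd_last(4)[OF q] by simp_all
  then show ?thesis by blast
qed

text \<open>
  Extending a path by a fixed path in front and a fixed path behind is injective, so finiteness of
  the set of paths passes to every pair of vertices in between.
\<close>

lemma (in wf_digraph) finite_paths_between: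
  assumes "finite (paths G u v)" "u \<rightarrow>\<^sup>* s" "t \<rightarrow>\<^sup>* v"
  shows "finite (paths G s t)"
proof -
  obtain a b where a: "a \<in> paths G u s" and b: "b \<in> paths G t v"
    using assms(2,3) reachable_iff_paths by blast
  let ?f = "\<lambda>p. butlast a @ (butlast p @ b)"
  have "?f ` paths G s t \<subseteq> paths G u v"
    using a b paths_join by blast
  moreover have "inj_on ?f (paths G s t)"
    by (rule inj_onI) (metis paths_hd_last(1,3) append_butlast_last_id same_append_eq append_same_eq)
  ultimately show ?thesis
    using assms(1) finite_subset finite_imageD by metis
qed

text \<open>
  A cycle can be put in front of a longest closed path.
\<close>

lemma (in wf_digraph) finite_paths_imp_no_cycle:
  assumes "finite (paths G u u)"
  shows "\<not> u \<rightarrow>\<^sup>+ u"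
proof
  assume "u \<rightarrow>\<^sup>+ u"
  then obtain w where w: "u \<rightarrow> w" "w \<rightarrow>\<^sup>* u"
    by (metis tranclD reachable_conv' adj_in_verts(2))
  then obtain c where c: "c \<in> paths G w u" using reachable_iff_paths by blast
  from w have "u \<in> verts G" by (simp add: adj_in_verts)
  then have u: "[u] \<in> paths G u u" by (simp add: paths_Cons)
  then have ne: "length ` paths G u u \<noteq> {}" by blast
  have fin: "finite (length ` paths G u u)" using assms by simp
  obtain p where p: "p \<in> paths G u u" "length p = Max (length ` paths G u u)"
    using Max_in[OF fin ne] by fastforce
  have "(u # butlast c) @ p \<in> paths G u u"
    using paths_join[of "u # c" u u p] p(1) c w \<open>u \<in> verts G\<close> paths_hd_last(1)[OF c]
    by (auto simp: paths_Cons)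
  then have "length ((u # butlast c) @ p) \<le> Max (length ` paths G u u)"
    using fin by (blast intro: Max_ge)
  with p(2) show False by simp
qed

lemma (in wf_digraph) trancl_iff_nontrivial_path:
  "u \<rightarrow>\<^sup>+ u \<longleftrightarrow> (\<exists>p \<in> paths G u u. length p > 1)"
proof
  assume "u \<rightarrow>\<^sup>+ u"
  then obtain w where w: "u \<rightarrow> w" "w \<rightarrow>\<^sup>* u"
    by (metis tranclD reachable_conv' adj_in_verts(2))
  then obtain c where c: "c \<in> paths G w u" using reachable_iff_paths by blast
  with w have "u # c \<in> paths G u u" by (auto simp: paths_Cons adj_in_verts)
  moreover have "length (u # c) > 1" using paths_hd_last(1)[OF c] by simp
  ultimately show "\<exists>p \<in> paths G u u. length p > 1" by blast
next
  assume "\<exists>p \<in> paths G u u. length p > 1"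
  then obtain p where p: "p \<in> paths G u u" "length p > 1" by blast
  then obtain a q where "p = a # q" "q \<noteq> []" by (cases p) auto
  with p obtain w where "u \<rightarrow> w" "q \<in> paths G w u" by (auto simp: paths_Cons)
  then show "u \<rightarrow>\<^sup>+ u"
    using reachable_iff_paths reachable_rtranclI by (metis empty_iff rtrancl_into_trancl2)
qed

lemma (in wf_digraph) no_oriented_cycle_iff:
  "(\<nexists>p. oriented_cycle G p) \<longleftrightarrow> (\<forall>u. \<not> u \<rightarrow>\<^sup>+ u)"
  unfolding oriented_cycle_def trancl_iff_nontrivial_path
  using paths_hd_last(7) by (metis One_nat_def vwalk_length_simp zero_less_diff)

lemma (in wf_digraph) paths_distinct:
  assumes acyc: "\<And>w. \<not> w \<rightarrow>\<^sup>+ w" and p: "p \<in> paths G u v"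
  shows "distinct p"
proof (rule ccontr)
  assume "\<not> distinct p"
  then obtain xs ys zs w where "p = xs @ [w] @ ys @ [w] @ zs"
    using not_distinct_decomp by blast
  then have "xs @ w # (ys @ w # zs) \<in> paths G u v" using p by simp
  then have "w # (ys @ w # zs) \<in> paths G w v" 
    using paths_append_Cons[of xs w "ys @ w # zs" u v] by blast
  then have "w # ys @ [w] \<in> paths G w w" using paths_append_Cons[of "w # ys" w zs w v] by simp
  then have "w \<rightarrow>\<^sup>+ w" unfolding trancl_iff_nontrivial_path by force
  with acyc show False by blast
qed

lemma (in wf_digraph) finite_paths_of_length:
  assumes "\<And>u. u \<in> verts G \<Longrightarrow> finite {w. u \<rightarrow> w}"
  shows "finite {p \<in> paths G u v. length p = n}"
proof (induction n arbitrary: u)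
  case 0
  have "{p \<in> paths G u v. length p = 0} = {}" by auto
  then show ?case by simp
next
  case (Suc n)
  show ?case
  proof (cases "u \<in> verts G")
    case True
    have "{p \<in> paths G u v. length p = Suc n} \<subseteq>
        insert [u] (Cons u ` (\<Union>w \<in> {w. u \<rightarrow> w}. {p \<in> paths G w v. length p = n}))" (is "_ \<subseteq> ?B")
    proof
      fix p assume "p \<in> {p \<in> paths G u v. length p = Suc n}"
      then show "p \<in> ?B" by (cases p) (auto simp: paths_Cons)
    qed
    moreover have "finite ?B" using Suc True assms by blast
    ultimately show ?thesis by (rule finite_subset)
  next
    case False
    then have "{p \<in> paths G u v. length p = Suc n} = {}" using paths_hd_last(7) by blast
    then show ?thesis by (simp only: finite.emptyI)
  qed
qed


section \<open>The structure of the stable translation quiver\<close>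

lemma verts_ZQ [simp]: "verts (ZQ Q) = UNIV \<times> verts Q"
  by (simp add: ZQ_def)

lemma ZQ_dominates [simp]:
  "(i, x) \<rightarrow>\<^bsub>ZQ Q\<^esub> (j, y) \<longleftrightarrow> i = j \<and> x \<rightarrow>\<^bsub>Q\<^esub> y \<or> j = i + 1 \<and> y \<rightarrow>\<^bsub>Q\<^esub> x"
proof -
  have "arcs_ends (ZQ Q) = (\<lambda>(i, a). ((i, tail Q a), (i, head Q a))) ` (UNIV \<times> arcs Q) \<union>
      (\<lambda>(i, a). ((i, head Q a), (i + 1, tail Q a))) ` (UNIV \<times> arcs Q)"
    unfolding arcs_ends_conv ZQ_def by (force simp: image_iff)
  then show ?thesis by (auto simp: arcs_ends_conv image_iff)
qed

lemma \<tau>_Pair [simp]: "\<tau> (i, x) = (i - 1, x)"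
  by (simp add: \<tau>_def)

lemma inv_\<tau>_power: "(inv \<tau> ^^ n) (i, x) = (i + int n, x)"
proof -
  have *: "inv \<tau> = (\<lambda>(i, x). (i + 1, x))"
    by (rule inv_unique_comp) (auto simp: \<tau>_def)
  show ?thesis by (induction n) (auto simp: *)
qed

lemma \<tau>_power: "(\<tau> ^^ n) (i, x) = (i - int n, x)"
  by (induction n) auto

text \<open>
  The integer powers of the inverse translation. They are automorphisms of \<open>ZQ Q\<close>, which allows to
  move any path to any level.
\<close>

definition shift :: "int \<Rightarrow> int \<times> 'v \<Rightarrow> int \<times> 'v" where
  "shift k = (\<lambda>(i, x). (i + k, x))"

lemma shift_Pair [simp]: "shift k (i, x) = (i + k, x)"
  by (simp add: shift_def)

lemma shift_dominates [simp]: "shift k u \<rightarrow>\<^bsub>ZQ Q\<^esub> shift k v \<longleftrightarrow> u \<rightarrow>\<^bsub>ZQ Q\<^esub> v"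
  by (cases u; cases v) auto

lemma \<tau>_eq_shift: "\<tau> = shift (- 1)"
  by (auto simp: \<tau>_def shift_def)

context wf_digraph
begin

interpretation Z: wf_digraph "ZQ G"
  by (rule wf_digraph_ZQ) (rule wf_digraph)

lemma paths_ZQ_shift:
  assumes "p \<in> paths (ZQ G) u v"
  shows "map (shift k) p \<in> paths (ZQ G) (shift k u) (shift k v)"
  using assms
proof (induction p arbitrary: u)
  case Nil
  then show ?case by simp
next
  case (Cons a p)
  have "shift k u \<in> verts (ZQ G) \<longleftrightarrow> u \<in> verts (ZQ G)" by (cases u) simp
  moreover have "p = [] \<and> u = v \<or>
      (\<exists>w. shift k u \<rightarrow>\<^bsub>ZQ G\<^esub> shift k w \<and> map (shift k) p \<in> paths (ZQ G) (shift k w) (shift k v))"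
    using Cons unfolding Z.paths_Cons shift_dominates by blast
  moreover have "a = u" "u \<in> verts (ZQ G)" using Cons.prems by (simp_all only: Z.paths_Cons)
  ultimately show ?case by (simp only: list.map Z.paths_Cons) blast
qed

lemma finite_paths_ZQ_shift:
  assumes "finite (paths (ZQ G) (i + k, x) (j + k, y))"
  shows "finite (paths (ZQ G) (i, x) (j, y))"
proof (rule finite_imageD)
  have "map (shift k) ` paths (ZQ G) (i, x) (j, y) \<subseteq> paths (ZQ G) (i + k, x) (j + k, y)"
    using paths_ZQ_shift[where u = "(i, x)" and v = "(j, y)" and k = k] by auto
  then show "finite (map (shift k) ` paths (ZQ G) (i, x) (j, y))"
    using assms by (rule finite_subset)
  show "inj_on (map (shift k)) (paths (ZQ G) (i, x) (j, y))"
    by (intro inj_on_mapI inj_onI) (auto simp: shift_def)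
qed

lemma reachable_ZQ_shift:
  "(i, x) \<rightarrow>\<^sup>*\<^bsub>ZQ G\<^esub> (j, y) \<Longrightarrow> (i + k, x) \<rightarrow>\<^sup>*\<^bsub>ZQ G\<^esub> (j + k, y)"
  using paths_ZQ_shift[of _ "(i, x)" "(j, y)" k] by (auto simp: Z.reachable_iff_paths)

lemma paths_ZQ_levels:
  assumes "p \<in> paths (ZQ G) (i, x) (j, y)" "w \<in> set p"
  shows "fst w \<in> {i..j}"
proof -
  have le: "i \<le> j" if "q \<in> paths (ZQ G) (i, x) (j, y)" for q i x j y
    using that by (induction q arbitrary: i x) (force simp: Z.paths_Cons)+
  obtain q r where "p = q @ w # r" using assms(2) by (auto simp: in_set_conv_decomp)
  then have "q @ [w] \<in> paths (ZQ G) (i, x) w" "w # r \<in> paths (ZQ G) w (j, y)"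
    using assms(1) Z.paths_append_Cons by blast+
  then show ?thesis using le by (cases w) auto
qed

lemma reachable_ZQ_level:
  "(i, x) \<rightarrow>\<^sup>*\<^bsub>ZQ G\<^esub> (j, y) \<Longrightarrow> i \<le> j"
  using paths_ZQ_levels Z.paths_hd_last(5) by (fastforce simp: Z.reachable_iff_paths)

text \<open>
  An arrow of the quiver can be traversed backwards in \<open>ZQ G\<close> at the cost of one level. So
  connectedness alone makes every vertex reachable at some later level.
\<close>

lemma connected_imp_reachable_ZQ:
  assumes "connected G" "x \<in> verts G" "y \<in> verts G"
  shows "\<exists>n::nat. (i, x) \<rightarrow>\<^sup>*\<^bsub>ZQ G\<^esub> (i + int n, y)"
proof -
  have "x \<rightarrow>\<^sup>*\<^bsub>mk_symmetric G\<^esub> y"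
    using assms by (auto simp: connected_def strongly_connected_def)
  then have "(x, y) \<in> (parcs (mk_symmetric G))\<^sup>*"
    by (auto dest: reachable_rtranclI)
  then show ?thesis
  proof (induction rule: rtrancl_induct)
    case base
    have "(i, x) \<rightarrow>\<^sup>*\<^bsub>ZQ G\<^esub> (i + int 0, x)" using assms by auto
    then show ?case by blast
  next
    case (step y z)
    then obtain n where n: "(i, x) \<rightarrow>\<^sup>*\<^bsub>ZQ G\<^esub> (i + int n, y)" by blast
    from step(2) have "y \<rightarrow> z \<or> z \<rightarrow> y" by (auto simp: parcs_mk_symmetric arcs_ends_conv)
    then have "(i + int n, y) \<rightarrow>\<^bsub>ZQ G\<^esub> (i + int n, z) \<or>
        (i + int n, y) \<rightarrow>\<^bsub>ZQ G\<^esub> (i + int (Suc n), z)" by auto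
    then show ?case using n Z.reachable_adj_trans by blast
  qed
qed

text \<open>
  Levels never decrease along a path, so a cycle of \<open>ZQ G\<close> stays in one level, which is a copy of
  the quiver itself.
\<close>

lemma ZQ_acyclic_iff: "(\<forall>u. \<not> u \<rightarrow>\<^sup>+\<^bsub>ZQ G\<^esub> u) \<longleftrightarrow> (\<forall>x. \<not> x \<rightarrow>\<^sup>+ x)"
proof -
  have 1: "(i, x) \<rightarrow>\<^sup>+\<^bsub>ZQ G\<^esub> (i, y)" if "x \<rightarrow>\<^sup>+ y" for i x y
    using that
  proof (induction rule: trancl_induct)
    case (base y)
    then show ?case by (intro r_into_trancl) simp
  next
    case (step y z)
    then show ?case by (intro trancl_into_trancl[OF step.IH]) simp
  qed
  have 2: "i \<le> j \<and> (i = j \<longrightarrow> x \<rightarrow>\<^sup>+ y)" if "(i, x) \<rightarrow>\<^sup>+\<^bsub>ZQ G\<^esub> (j, y)" for i x j y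
    using that
  proof (induction j y rule: trancl_induct2)
    case (base j y)
    then show ?case by auto
  next
    case (step j y k z)
    then show ?case by (auto intro: trancl_into_trancl)
  qed
  show ?thesis
  proof
    assume "\<forall>u. \<not> u \<rightarrow>\<^sup>+\<^bsub>ZQ G\<^esub> u"
    then show "\<forall>x. \<not> x \<rightarrow>\<^sup>+ x" using 1 by blast
  next
    assume *: "\<forall>x. \<not> x \<rightarrow>\<^sup>+ x"
    show "\<forall>u. \<not> u \<rightarrow>\<^sup>+\<^bsub>ZQ G\<^esub> u"
    proof (intro allI notI)
      fix u assume "u \<rightarrow>\<^sup>+\<^bsub>ZQ G\<^esub> u"
      then show False using 2[of "fst u" "snd u" "fst u" "snd u"] * by simp
    qed
  qed
qed

lemma locally_finite_ZQ_out:
  assumes "locally_finite G" "u \<in> verts (ZQ G)"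
  shows "finite {w. u \<rightarrow>\<^bsub>ZQ G\<^esub> w}"
proof -
  obtain i x where u: "u = (i, x)" by (cases u)
  let ?N = "{y. x \<rightarrow> y \<or> y \<rightarrow> x}"
  have "{w. u \<rightarrow>\<^bsub>ZQ G\<^esub> w} \<subseteq> {i, i + 1} \<times> ?N" using u by auto
  moreover have "finite ?N" using assms u by (auto simp: locally_finite_def)
  ultimately show ?thesis by (meson finite.intros finite_SigmaI finite_subset)
qed

end


section \<open>Unoriented paths and round trips\<close>

abbreviation backward_steps :: "'e step list \<Rightarrow> nat" where
  "backward_steps p \<equiv> length (filter is_Bwd p)"

lemma double_quiver_simps:
  "verts (double_quiver Q) = verts Q"
  "arcs (double_quiver Q) = Fwd ` arcs Q \<union> Bwd ` arcs Q"
  "tail (double_quiver Q) = step_tail Q"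
  "head (double_quiver Q) = step_head Q"
  by (simp_all add: double_quiver_def)

context wf_digraph
begin

interpretation Z: wf_digraph "ZQ G"
  by (rule wf_digraph_ZQ) (rule wf_digraph)

interpretation D: wf_digraph "double_quiver G"
  by unfold_locales (auto simp: double_quiver_simps)

text \<open>
  Unoriented paths of \<open>G\<close> with \<open>n\<close> backward steps are the same as paths of \<open>ZQ G\<close> that climb
  \<open>n\<close> levels, once the starting level is chosen: \<open>Level\<close> arrows are the forward steps and
  \<open>Shift\<close> arrows the backward steps. This lemma and the next one give the two directions.
\<close>

lemma awalk_lifts_to_ZQ:
  assumes "D.awalk x p y"
  shows "\<exists>q \<in> paths (ZQ G) (i, x) (i + int (backward_steps p), y). map snd q = D.awalk_verts x p"
  using assms
proof (induction p arbitrary: x i)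
  case Nil
  then have "[(i, x)] \<in> paths (ZQ G) (i, x) (i + int (backward_steps []), y)"
    by (auto simp: D.awalk_Nil_iff Z.paths_Cons double_quiver_simps)
  then show ?case by (intro bexI) simp_all
next
  case (Cons e p)
  let ?z = "step_head G e" and ?j = "i + int (backward_steps [e])"
  have e: "e \<in> Fwd ` arcs G \<union> Bwd ` arcs G" "x = step_tail G e" "D.awalk ?z p y"
    using Cons.prems by (simp_all add: D.awalk_Cons_iff double_quiver_simps)
  obtain q where q: "q \<in> paths (ZQ G) (?j, ?z) (?j + int (backward_steps p), y)"
      "map snd q = D.awalk_verts ?z p"
    using Cons.IH[OF e(3)] by blast
  have "(i, x) \<rightarrow>\<^bsub>ZQ G\<^esub> (?j, ?z)"
    using e(1,2) by (auto simp: in_arcs_imp_in_arcs_ends)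
  from Z.paths_ConsI[OF this q(1)]
  have "(i, x) # q \<in> paths (ZQ G) (i, x) (i + int (backward_steps (e # p)), y)"
    by (cases e) (simp_all add: add.assoc)
  then show ?case using q(2) e(2) by (intro bexI) (simp_all add: double_quiver_simps)
qed

lemma paths_ZQ_project:
  assumes "q \<in> paths (ZQ G) (i, x) (j, y)"
  shows "\<exists>p. D.awalk x p y \<and> D.awalk_verts x p = map snd q \<and> j = i + int (backward_steps p)"
  using assms
proof (induction q arbitrary: i x)
  case Nil
  then show ?case by simp
next
  case (Cons a q)
  have x: "a = (i, x)" "x \<in> verts G" using Cons.prems by (simp_all add: Z.paths_Cons)
  show ?case
  proof (cases "q = []")
    case True
    then have "y = x" "j = i" using Cons.prems by (auto simp: Z.paths_Cons)
    with True x show ?thesis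
      by (intro exI[of _ "[]"]) (simp add: D.awalk_Nil_iff double_quiver_simps)
  next
    case False
    then obtain k z where kz: "(i, x) \<rightarrow>\<^bsub>ZQ G\<^esub> (k, z)" "q \<in> paths (ZQ G) (k, z) (j, y)"
      using Cons.prems by (force simp: Z.paths_Cons)
    then obtain p where p: "D.awalk z p y" "D.awalk_verts z p = map snd q"
        "j = k + int (backward_steps p)"
      using Cons.IH by blast
    obtain e where e: "e \<in> Fwd ` arcs G \<union> Bwd ` arcs G" "step_tail G e = x" "step_head G e = z"
        "k = i + int (backward_steps [e])"
    proof -
      from kz(1) consider "k = i" "x \<rightarrow> z" | "k = i + 1" "z \<rightarrow> x" by auto
      then show thesis
      proof cases
        case 1
        then obtain a where "a \<in> arcs G" "tail G a = x" "head G a = z" by blast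
        with 1 show thesis by (intro that[of "Fwd a"]) auto
      next
        case 2
        then obtain a where "a \<in> arcs G" "tail G a = z" "head G a = x" by blast
        with 2 show thesis by (intro that[of "Bwd a"]) auto
      qed
    qed
    have "D.awalk x (e # p) y" using e p by (simp add: D.awalk_Cons_iff double_quiver_simps)
    moreover have "D.awalk_verts x (e # p) = map snd (a # q)"
      using e p x by (simp add: double_quiver_simps)
    moreover have "j = i + int (backward_steps (e # p))" using e p by simp
    ultimately show ?thesis by blast
  qed
qed

lemma round_trip_iff_path_ZQ:
  "(\<exists>p \<in> round_trips G x y. n = backward_steps p) \<longleftrightarrow>
   (\<exists>q \<in> paths (ZQ G) (i, x) (i + int n, x). y \<in> snd ` set q)"
proof
  assume "\<exists>p \<in> round_trips G x y. n = backward_steps p"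
  then obtain p where "D.awalk x p x" "y \<in> set (D.awalk_verts x p)" "n = backward_steps p"
    by (auto simp: round_trips_def)
  then show "\<exists>q \<in> paths (ZQ G) (i, x) (i + int n, x). y \<in> snd ` set q"
    using awalk_lifts_to_ZQ[of x p x i] by (metis list.set_map)
next
  assume "\<exists>q \<in> paths (ZQ G) (i, x) (i + int n, x). y \<in> snd ` set q"
  then obtain q where "q \<in> paths (ZQ G) (i, x) (i + int n, x)" "y \<in> snd ` set q" by blast
  then obtain p where "D.awalk x p x" "y \<in> set (D.awalk_verts x p)" "n = backward_steps p"
    using paths_ZQ_project[of q i x "i + int n" x] by (metis add_left_cancel list.set_map of_nat_eq_iff)
  then show "\<exists>p \<in> round_trips G x y. n = backward_steps p"
    by (auto simp: round_trips_def)
qed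

lemma round_trip_distance_le:
  assumes "q \<in> paths (ZQ G) (i, x) (i + int n, x)" "y \<in> snd ` set q"
  shows "round_trip_distance G x y \<le> n"
  unfolding round_trip_distance_def
  using assms round_trip_iff_path_ZQ[of x y n i] by (intro Least_le) blast

lemma path_ZQ_of_round_trip_distance:
  assumes "connected G" "x \<in> verts G" "y \<in> verts G"
  shows "\<exists>q \<in> paths (ZQ G) (i, x) (i + int (round_trip_distance G x y), x). y \<in> snd ` set q"
proof -
  obtain m n :: nat where m: "(i, x) \<rightarrow>\<^sup>*\<^bsub>ZQ G\<^esub> (i + int m, y)"
    and n: "(i + int m, y) \<rightarrow>\<^sup>*\<^bsub>ZQ G\<^esub> (i + int m + int n, x)"
    using connected_imp_reachable_ZQ assms by blast
  have "\<exists>q \<in> paths (ZQ G) (i, x) (i + int (m + n), x). y \<in> snd ` set q"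
    using Z.path_through[OF m n] by (force simp: add.assoc)
  then have "\<exists>p \<in> round_trips G x y. m + n = backward_steps p"
    unfolding round_trip_iff_path_ZQ[of x y _ i] by blast
  then have "\<exists>p \<in> round_trips G x y. round_trip_distance G x y = backward_steps p"
    unfolding round_trip_distance_def by (rule LeastI)
  then show ?thesis unfolding round_trip_iff_path_ZQ[of x y _ i] .
qed

text \<open>
  All of the sphere is visited by the paths from \<open>x\<close> to its \<open>n\<close>-fold inverse translate, each of
  which visits finitely many vertices.
\<close>

lemma finite_paths_imp_finite_sphere:
  assumes "connected G" "x \<in> verts G" "finite (paths (ZQ G) (i, x) (i + int n, x))"
  shows "finite (round_trip_sphere G x n)"
proof -
  have "round_trip_sphere G x n \<subseteq> (\<Union>q \<in> paths (ZQ G) (i, x) (i + int n, x). snd ` set q)"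
    using path_ZQ_of_round_trip_distance[OF assms(1,2), of _ i]
    by (auto simp: round_trip_sphere_def)
  then show ?thesis using assms(3) by (meson List.finite_set finite_UN finite_imageI finite_subset)
qed

text \<open>
  A path from \<open>x\<close> to its \<open>n\<close>-fold inverse translate is a round trip through each of its vertices, so
  it stays within the finitely many spheres of radius at most \<open>n\<close> and within \<open>n + 1\<close> levels. It has
  no repeated vertex, since there are no cycles, and a finite set has only finitely many lists of
  distinct elements.
\<close>

lemma finite_spheres_imp_finite_paths:
  assumes acyc: "\<nexists>p. oriented_cycle G p" and fin: "\<And>n. finite (round_trip_sphere G x n)"
  shows "finite (paths (ZQ G) (i, x) (i + int n, x))"
proof -
  let ?B = "{i..i + int n} \<times> (\<Union>m \<in> {..n}. round_trip_sphere G x m)"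
  have acycZ: "\<not> u \<rightarrow>\<^sup>+\<^bsub>ZQ G\<^esub> u" for u
    using acyc ZQ_acyclic_iff no_oriented_cycle_iff by blast
  have "paths (ZQ G) (i, x) (i + int n, x) \<subseteq> {q. set q \<subseteq> ?B \<and> distinct q}"
  proof safe
    fix q j y assume q: "q \<in> paths (ZQ G) (i, x) (i + int n, x)" and y: "(j, y) \<in> set q"
    show "j \<in> {i..i + int n}" using paths_ZQ_levels[OF q y] by simp
    have "y \<in> snd ` set q" using y by force
    moreover have "y \<in> verts G" using Z.paths_hd_last(6)[OF q] y by auto
    ultimately show "y \<in> (\<Union>m \<in> {..n}. round_trip_sphere G x m)"
      using round_trip_distance_le[OF q] by (auto simp: round_trip_sphere_def)
  next
    fix q assume "q \<in> paths (ZQ G) (i, x) (i + int n, x)"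
    then show "distinct q" using acycZ Z.paths_distinct by blast
  qed
  moreover have "finite {q. set q \<subseteq> ?B \<and> distinct q}"
    using fin by (intro finite_subset_distinct) auto
  ultimately show ?thesis by (rule finite_subset)
qed

text \<open>
  Finiteness at one vertex spreads to all of \<open>ZQ G\<close>: by connectedness, both endpoints lie between
  translates of the base vertex, and these may be moved back by a shift.
\<close>

lemma finite_paths_ZQ_of_base:
  assumes "connected G" "(i, x) \<in> verts (ZQ G)" 
    and fin: "\<And>n::nat. finite (paths (ZQ G) (i, x) (i + int n, x))"
    and "u \<in> verts (ZQ G)" "v \<in> verts (ZQ G)"
  shows "finite (paths (ZQ G) u v)"
proof -
  obtain j y k z where uv: "u = (j, y)" "v = (k, z)" by (cases u, cases v)
  have V: "x \<in> verts G" "y \<in> verts G" "z \<in> verts G" using assms uv by auto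
  obtain m n :: nat where m: "(j, x) \<rightarrow>\<^sup>*\<^bsub>ZQ G\<^esub> (j + int m, y)"
    and n: "(k, z) \<rightarrow>\<^sup>*\<^bsub>ZQ G\<^esub> (k + int n, x)"
    using connected_imp_reachable_ZQ assms(1) V by blast
  have from_x: "(j - int m, x) \<rightarrow>\<^sup>*\<^bsub>ZQ G\<^esub> (j, y)"
    using reachable_ZQ_shift[OF m, of "- int m"] by simp
  show ?thesis
  proof (cases "paths (ZQ G) u v = {}")
    case False
    then have "(j - int m, x) \<rightarrow>\<^sup>*\<^bsub>ZQ G\<^esub> (k + int n, x)"
      using from_x n uv Z.reachable_iff_paths Z.reachable_trans by metis
    then have "j - int m \<le> k + int n" by (rule reachable_ZQ_level)
    then obtain l where l: "k + int n = j - int m + int l" by (metis zle_iff_zadd)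
    have "j - int m + (i - j + int m) = i" "k + int n + (i - j + int m) = i + int l"
      using l by simp_all
    then have "finite (paths (ZQ G) (j - int m, x) (k + int n, x))"
      using finite_paths_ZQ_shift fin by metis
    then show ?thesis using from_x n uv Z.finite_paths_between by blast
  qed simp
qed


section \<open>Local finiteness and sectional paths\<close>

text \<open>
  Each neighbor \<open>y\<close> of \<open>x\<close> is the middle vertex of a path of length two from \<open>x\<close> to its inverse
  translate, whichever direction the arrow between them has.
\<close>

lemma finite_paths_imp_locally_finite:
  assumes fin: "\<And>u v. \<lbrakk>u \<in> verts (ZQ G); v \<in> verts (ZQ G)\<rbrakk> \<Longrightarrow> finite (paths (ZQ G) u v)"
  shows "locally_finite G"
  unfolding locally_finite_def
proof
  fix x assume x: "x \<in> verts G"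
  have "{y. x \<rightarrow> y \<or> y \<rightarrow> x} \<subseteq> (\<Union>q \<in> paths (ZQ G) (0, x) (1, x). snd ` set q)"
  proof
    fix y assume "y \<in> {y. x \<rightarrow> y \<or> y \<rightarrow> x}"
    then have "[(0, x), (0, y), (1, x)] \<in> paths (ZQ G) (0, x) (1, x) \<or>
               [(0, x), (1, y), (1, x)] \<in> paths (ZQ G) (0, x) (1, x)"
      using x by (auto simp: Z.paths_Cons dest: adj_in_verts)
    then show "y \<in> (\<Union>q \<in> paths (ZQ G) (0, x) (1, x). snd ` set q)" by force
  qed
  moreover have "finite (paths (ZQ G) (0, x) (1, x))" using fin x by simp
  ultimately show "finite {y. x \<rightarrow> y \<or> y \<rightarrow> x}"
    by (meson List.finite_set finite_UN finite_imageI finite_subset)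
qed

text \<open>
  A path that is not sectional contains a piece \<open>\<tau> c \<rightarrow> b \<rightarrow> c\<close>. Cutting this piece out and translating
  the remainder by \<open>\<tau>\<close> gives a path that has two arrows less and ends one level lower.
\<close>

lemma path_reduces_to_sectional_path:
  assumes "p \<in> paths (ZQ G) u v"
  shows "\<exists>k. \<exists>q \<in> sectional_paths G u ((\<tau> ^^ k) v). length p = length q + 2 * k"
  using assms
proof (induction "length p" arbitrary: p v rule: less_induct)
  case less
  show ?case
  proof (cases "p \<in> sectional_paths G u v")
    case True
    then show ?thesis by (intro exI[of _ 0]) auto
  next
    case False
    then obtain i where i: "i + 2 < length p" "p ! i = \<tau> (p ! (i + 2))"
      using less.prems by (auto simp: sectional_paths_def)
    \<comment> \<open>In the split \<open>p = r @ \<tau> c # b # c # s\<close> the part \<open>\<tau> c # b\<close> is removed.\<close>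
    define r b c s where defs: "r = take i p" "b = p ! (i + 1)" "c = p ! (i + 2)" "s = drop (i + 3) p"
    have "drop i p = p ! i # p ! (i + 1) # p ! (i + 2) # drop (i + 3) p"
      using i(1) by (simp add: Cons_nth_drop_Suc[symmetric] numeral_eq_Suc)
    then have p: "p = r @ \<tau> c # (b # c # s)"
      using i(2) append_take_drop_id[of i p] unfolding defs by simp
    have r: "r @ [\<tau> c] \<in> paths (ZQ G) u (\<tau> c)" and bcs: "\<tau> c # b # c # s \<in> paths (ZQ G) (\<tau> c) v"
      using less.prems Z.paths_append_Cons[of r "\<tau> c" "b # c # s" u v] unfolding p by blast+
    have "c # s \<in> paths (ZQ G) c v"
      using bcs Z.paths_append_Cons[of "[\<tau> c, b]" c s "\<tau> c" v] by simp
    then have "map \<tau> (c # s) \<in> paths (ZQ G) (\<tau> c) (\<tau> v)"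
      using paths_ZQ_shift[of "c # s" c v "-1"] by (simp only: \<tau>_eq_shift)
    then have "r @ map \<tau> (c # s) \<in> paths (ZQ G) u (\<tau> v)"
      using Z.paths_join[OF r] by fastforce
    moreover have "length (r @ map \<tau> (c # s)) + 2 = length p" using p by simp
    ultimately obtain k q where
      "q \<in> sectional_paths G u ((\<tau> ^^ k) (\<tau> v))" "length p = length q + 2 * Suc k"
      using less.hyps[of "r @ map \<tau> (c # s)" "\<tau> v"] by force
    then show ?thesis by (intro exI[of _ "Suc k"]) (auto simp: funpow_swap1)
  qed
qed

text \<open>
  Only as many pieces can be cut out of a path from \<open>u\<close> to \<open>v\<close> as there are levels between
  them. Hence arbitrarily long paths would leave arbitrarily long sectional paths to one of finitely
  many translates of \<open>v\<close>. So the lengths are bounded, and local finiteness does the rest.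
\<close>

lemma finite_sectional_paths_imp_finite_paths:
  assumes loc: "locally_finite G"
    and fin: "\<And>u v. \<lbrakk>u \<in> verts (ZQ G); v \<in> verts (ZQ G)\<rbrakk> \<Longrightarrow> finite (sectional_paths G u v)"
    and u: "u \<in> verts (ZQ G)" and v: "v \<in> verts (ZQ G)"
  shows "finite (paths (ZQ G) u v)"
proof -
  obtain i x j y where uv: "u = (i, x)" "v = (j, y)" by (cases u, cases v)
  define L where "L = (\<Union>k \<in> {..nat (j - i)}. (\<lambda>q. length q + 2 * k) ` sectional_paths G u ((\<tau> ^^ k) v))"
  have "(\<tau> ^^ k) v \<in> verts (ZQ G)" for k using v uv by (simp add: \<tau>_power)
  then have "finite L" unfolding L_def using fin u by blast
  have "length p \<in> L" if p: "p \<in> paths (ZQ G) u v" for p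
  proof -
    obtain k q where q: "q \<in> sectional_paths G u ((\<tau> ^^ k) v)" "length p = length q + 2 * k"
      using path_reduces_to_sectional_path[OF p] by blast
    then have "(i, x) \<rightarrow>\<^sup>*\<^bsub>ZQ G\<^esub> (j - int k, y)"
      using uv Z.reachable_iff_paths by (auto simp: sectional_paths_def \<tau>_power)
    then have "k \<le> nat (j - i)" using reachable_ZQ_level by fastforce
    then show ?thesis using q unfolding L_def by blast
  qed
  then have "paths (ZQ G) u v \<subseteq> (\<Union>l \<in> L. {p \<in> paths (ZQ G) u v. length p = l})" by blast
  moreover have "finite (\<Union>l \<in> L. {p \<in> paths (ZQ G) u v. length p = l})"
    using \<open>finite L\<close> Z.finite_paths_of_length locally_finite_ZQ_out[OF loc] by blast
  ultimately show ?thesis by (rule finite_subset)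
qed

end


section \<open>Strongly locally finite quivers\<close>

lemma (in wf_digraph) finite_paths_by_successors:
  assumes "finite {w. u \<rightarrow> w}" "\<And>w. u \<rightarrow> w \<Longrightarrow> finite (paths G w v)"
  shows "finite (paths G u v)"
proof -
  have "paths G u v \<subseteq> insert [u] (Cons u ` (\<Union>w \<in> {w. u \<rightarrow> w}. paths G w v))" (is "_ \<subseteq> ?B")
  proof
    fix p assume "p \<in> paths G u v"
    then show "p \<in> ?B" by (cases p) (auto simp: paths_Cons)
  qed
  moreover have "finite ?B" using assms by blast
  ultimately show ?thesis by (rule finite_subset)
qed

text \<open>
  Well-founded induction on the starting vertex: an arrow of \<open>ZQ G\<close> either climbs a level, which can
  happen only finitely often below the target, or is an arrow of \<open>G\<close>, along which there is no
  infinite path. Local finiteness leaves finitely many successors to consider.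
\<close>

lemma (in wf_digraph) path_finite_imp_finite_paths_ZQ:
  assumes "locally_finite G" "path_finite G"
  shows "finite (paths (ZQ G) u v)"
proof -
  interpret Z: wf_digraph "ZQ G" by (rule wf_digraph_ZQ) (rule wf_digraph)
  obtain j z where v: "v = (j, z)" by (cases v)
  let ?r = "{(y, x). x \<rightarrow> y}"
  \<comment> \<open>The bound \<open>j + 1 - i\<close> is positive for all levels \<open>i \<le> j\<close>, and so decreases strictly even on
    leaving level \<open>j\<close>.\<close>
  let ?R = "inv_image (less_than <*lex*> ?r) (\<lambda>(i, x). (nat (j + 1 - i), x))"
  have "wf ?r" using assms(2) by (simp add: wf_iff_no_infinite_down_chain path_finite_def)
  then have "wf ?R" by auto
  then show ?thesis
  proof (induction u)
    case (less u)
    obtain i x where u: "u = (i, x)" by (cases u)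
    show ?case
    proof (cases "u \<in> verts (ZQ G) \<and> i \<le> j")
      case False
      then have "paths (ZQ G) u v = {}"
        using u v reachable_ZQ_level Z.reachable_iff_paths Z.paths_hd_last(7) by blast
      then show ?thesis by simp
    next
      case True
      show ?thesis
      proof (rule Z.finite_paths_by_successors)
        show "finite {w. u \<rightarrow>\<^bsub>ZQ G\<^esub> w}" using True assms(1) locally_finite_ZQ_out by blast
        show "finite (paths (ZQ G) w v)" if w: "u \<rightarrow>\<^bsub>ZQ G\<^esub> w" for w
          using True w u by (intro less) (cases w, auto)
      qed
    qed
  qed
qed

lemma (in wf_digraph) paths_app_iso:
  assumes h: "digraph_isomorphism h" and "u \<in> verts G" "v \<in> verts G"
  shows "paths (app_iso h G) (iso_verts h u) (iso_verts h v) \<subseteq> map (iso_verts h) ` paths G u v"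
proof
  interpret H: wf_digraph "app_iso h G" using h by (rule wf_digraphI_app_iso)
  fix p assume "p \<in> paths (app_iso h G) (iso_verts h u) (iso_verts h v)"
  then show "p \<in> map (iso_verts h) ` paths G u v" using assms(2)
  proof (induction p arbitrary: u)
    case Nil
    then show ?case by simp
  next
    case (Cons a p)
    then have a: "a = iso_verts h u" by (simp add: H.paths_Cons)
    show ?case
    proof (cases "p = []")
      case True
      then have "u = v" using Cons.prems h assms(3) by (auto simp: H.paths_Cons)
      then have "[u] \<in> paths G u v" using Cons.prems by (simp add: paths_Cons)
      then show ?thesis using True a by (force simp: image_iff)
    next
      case False
      then obtain w where w: "iso_verts h u \<rightarrow>\<^bsub>app_iso h G\<^esub> w"
          "p \<in> paths (app_iso h G) w (iso_verts h v)"
        using Cons.prems by (auto simp: H.paths_Cons)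
      from w(1) obtain u' w' where u': "u' \<rightarrow> w'" "iso_verts h u = iso_verts h u'" "w = iso_verts h w'"
        by (auto simp: arcs_ends_app_iso_eq[OF h])
      then have "u' = u" "w' \<in> verts G"
        using Cons.prems h adj_in_verts[OF u'(1)] by auto
      then obtain q where "q \<in> paths G w' v" "p = map (iso_verts h) q"
        using Cons.IH[of w'] w u' by blast
      then have "u # q \<in> paths G u v" "a # p = map (iso_verts h) (u # q)"
        using u' \<open>u' = u\<close> a by (auto intro: paths_ConsI)
      then show ?thesis by (metis imageI)
    qed
  qed
qed

lemma finite_paths_ZQ_of_section:
  assumes "is_section S Q" "strongly_locally_finite S"
    and uv: "u \<in> verts (ZQ Q)" "v \<in> verts (ZQ Q)"
  shows "finite (paths (ZQ Q) u v)"
proof -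
  obtain h where h: "pre_digraph.digraph_isomorphism (ZQ S) h" "app_iso h (ZQ S) = ZQ Q"
    using assms(1) by (auto simp: is_section_def)
  interpret S: wf_digraph S
    using assms(1) by (auto simp: is_section_def induced_subgraph_def subgraph_def)
  interpret Z: wf_digraph "ZQ S" by (rule wf_digraph_ZQ) (rule S.wf_digraph)
  have "verts (ZQ Q) = iso_verts h ` verts (ZQ S)" by (metis h(2) verts_app_iso)
  then obtain u' v' where u': "u' \<in> verts (ZQ S)" "u = iso_verts h u'"
      and v': "v' \<in> verts (ZQ S)" "v = iso_verts h v'"
    using uv by blast
  have "paths (ZQ Q) u v \<subseteq> map (iso_verts h) ` paths (ZQ S) u' v'"
    using Z.paths_app_iso[OF h(1) u'(1) v'(1)] u' v' h(2) by metis
  moreover have "finite (paths (ZQ S) u' v')"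
    using assms(2) S.path_finite_imp_finite_paths_ZQ by (simp add: strongly_locally_finite_def)
  ultimately show ?thesis by (meson finite_imageI finite_subset)
qed


section \<open>Sections as graphs of level functions\<close>

text \<open>
  The action on arrows of the canonical isomorphism from \<open>ZQ S\<close> to \<open>ZQ Q\<close> for a section \<open>S\<close>; on
  vertices it sends \<open>(n, (k, x))\<close> to \<open>(n + k, x)\<close>. In the last equation, the
  arrow goes backwards along a \<open>Shift k\<close> arrow, from \<open>k + 1\<close> to \<open>k\<close>, while the outer level rises
  from \<open>n\<close> to \<open>n + 1\<close>, so it stays in level \<open>n + k + 1\<close>.
\<close>

fun unnest_arrow :: "'e zarrow zarrow \<Rightarrow> 'e zarrow" where
  "unnest_arrow (Level n (Level k a)) = Level (n + k) a"
| "unnest_arrow (Level n (Shift k a)) = Shift (n + k) a"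
| "unnest_arrow (Shift n (Level k a)) = Shift (n + k) a"
| "unnest_arrow (Shift n (Shift k a)) = Level (n + k + 1) a"

definition graph_slice ::
    "('v, 'e) pre_digraph \<Rightarrow> ('v \<Rightarrow> int) \<Rightarrow> (int \<times> 'v, 'e zarrow) pre_digraph" where
  "graph_slice Q f = ZQ Q \<restriction> (\<lambda>x. (f x, x)) ` verts Q"

lemma tail_ZQ: "tail (ZQ Q) = ztail Q" and head_ZQ: "head (ZQ Q) = zhead Q"
  and arcs_ZQ: "arcs (ZQ Q) = {Level i a | i a. a \<in> arcs Q} \<union> {Shift i a | i a. a \<in> arcs Q}"
  by (simp_all add: ZQ_def)

text \<open>
  If the level drops by zero or one along each arrow \<open>x \<rightarrow> y\<close>, exactly one arrow between the chosen
  copies of \<open>x\<close> and \<open>y\<close> comes from the given one: a \<open>Level\<close> arrow in the first case, a \<open>Shift\<close> arrow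
  in the opposite direction in the second. So the graph of such a function is a copy of \<open>G\<close> with some
  arrows reversed, and it is a section.
\<close>

locale slice_function = wf_digraph +
  fixes f :: "'a \<Rightarrow> int"
  assumes head_le_tail: "x \<rightarrow> y \<Longrightarrow> f y \<le> f x"
    and tail_le_Suc_head: "x \<rightarrow> y \<Longrightarrow> f x \<le> f y + 1"
begin

abbreviation "S \<equiv> graph_slice G f"

sublocale Z: wf_digraph "ZQ G"
  by (rule wf_digraph_ZQ) (rule wf_digraph)

lemma induced_slice: "induced_subgraph S (ZQ G)"
  unfolding graph_slice_def by (rule Z.induced_induce) auto

sublocale S: wf_digraph S
  using induced_slice by (auto simp: induced_subgraph_def subgraph_def)

lemma verts_slice: "verts S = (\<lambda>x. (f x, x)) ` verts G"
  by (simp add: graph_slice_def)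

lemma slice_vertex: "u \<in> verts S \<Longrightarrow> u = (f (snd u), snd u)"
  by (auto simp: verts_slice)

lemma arcs_slice:
  "arcs S = {Level (f (tail G a)) a | a. a \<in> arcs G \<and> f (tail G a) = f (head G a)} \<union>
            {Shift (f (head G a)) a | a. a \<in> arcs G \<and> f (tail G a) = f (head G a) + 1}"
  by (auto simp: graph_slice_def arcs_ZQ tail_ZQ head_ZQ image_iff)

lemma tail_slice: "tail S = ztail G" and head_slice: "head S = zhead G"
  by (simp_all add: graph_slice_def tail_ZQ head_ZQ)

lemma slice_dominates_imp: "u \<rightarrow>\<^bsub>S\<^esub> v \<Longrightarrow> u \<rightarrow>\<^bsub>ZQ G\<^esub> v"
  using arcs_ends_mono[of S "ZQ G"] induced_slice by (auto simp: induced_subgraph_def)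

lemma arrow_cases:
  assumes "a \<in> arcs G"
  shows "f (tail G a) = f (head G a) \<or> f (tail G a) = f (head G a) + 1"
  using head_le_tail tail_le_Suc_head in_arcs_imp_in_arcs_ends[OF assms] by fastforce

lemma slice_is_section: "is_section S G"
proof -
  define h where "h = \<lparr>iso_verts = (\<lambda>(n, k, x). (n + k, x)), iso_arcs = unnest_arrow,
      iso_head = zhead G, iso_tail = ztail G\<rparr>"
  have h_simps: "iso_verts h = (\<lambda>(n, k, x). (n + k, x))" "iso_arcs h = unnest_arrow"
      "iso_head h = zhead G" "iso_tail h = ztail G"
    by (simp_all add: h_def)
  have arcs_ZS: "arcs (ZQ S) =
      {Level i (Level (f (tail G a)) a) | i a. a \<in> arcs G \<and> f (tail G a) = f (head G a)} \<union>
      {Level i (Shift (f (head G a)) a) | i a. a \<in> arcs G \<and> f (tail G a) = f (head G a) + 1} \<union>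
      {Shift i (Level (f (tail G a)) a) | i a. a \<in> arcs G \<and> f (tail G a) = f (head G a)} \<union>
      {Shift i (Shift (f (head G a)) a) | i a. a \<in> arcs G \<and> f (tail G a) = f (head G a) + 1}"
    unfolding arcs_ZQ arcs_slice by auto
  have "wf_digraph (ZQ S)" by (rule wf_digraph_ZQ) (rule S.wf_digraph)
  moreover have "inj_on (iso_verts h) (verts (ZQ S))"
    by (auto simp: inj_on_def h_simps verts_slice)
  moreover have "inj_on (iso_arcs h) (arcs (ZQ S))"
    unfolding arcs_ZS by (rule inj_onI) (auto simp: h_simps)
  moreover have "\<forall>e \<in> arcs (ZQ S). iso_verts h (tail (ZQ S) e) = iso_tail h (iso_arcs h e) \<and>
      iso_verts h (head (ZQ S) e) = iso_head h (iso_arcs h e)"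
    unfolding arcs_ZS tail_ZQ head_ZQ by (auto simp: h_simps tail_slice head_slice)
  ultimately have iso: "pre_digraph.digraph_isomorphism (ZQ S) h"
    by (simp add: pre_digraph.digraph_isomorphism_def)
  have "iso_verts h ` verts (ZQ S) = verts (ZQ G)"
  proof
    show "verts (ZQ G) \<subseteq> iso_verts h ` verts (ZQ S)"
    proof
      fix u assume "u \<in> verts (ZQ G)"
      then obtain i x where "u = (i, x)" "x \<in> verts G" by auto
      then show "u \<in> iso_verts h ` verts (ZQ S)"
        by (intro image_eqI[of _ _ "(i - f x, f x, x)"]) (auto simp: h_simps verts_slice)
    qed
  qed (auto simp: h_simps verts_slice)
  moreover have "iso_arcs h ` arcs (ZQ S) = arcs (ZQ G)"
  proof
    show "iso_arcs h ` arcs (ZQ S) \<subseteq> arcs (ZQ G)"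
      unfolding arcs_ZS by (auto simp: h_simps arcs_ZQ)
    show "arcs (ZQ G) \<subseteq> iso_arcs h ` arcs (ZQ S)"
    proof
      fix e assume "e \<in> arcs (ZQ G)"
      then obtain i a where e: "e = Level i a \<or> e = Shift i a" and a: "a \<in> arcs G"
        by (auto simp: arcs_ZQ)
      let ?s = "f (tail G a)" and ?t = "f (head G a)"
      from arrow_cases[OF a] show "e \<in> iso_arcs h ` arcs (ZQ S)"
      proof
        assume *: "?s = ?t"
        then have "Level (i - ?s) (Level ?s a) \<in> arcs (ZQ S)" "Shift (i - ?s) (Level ?s a) \<in> arcs (ZQ S)"
          using a unfolding arcs_ZS by auto
        moreover have "iso_arcs h (Level (i - ?s) (Level ?s a)) = Level i a"
            "iso_arcs h (Shift (i - ?s) (Level ?s a)) = Shift i a" by (simp_all add: h_simps)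
        ultimately show ?thesis using e by (metis imageI)
      next
        assume *: "?s = ?t + 1"
        then have "Shift (i - ?t - 1) (Shift ?t a) \<in> arcs (ZQ S)" "Level (i - ?t) (Shift ?t a) \<in> arcs (ZQ S)"
          using a unfolding arcs_ZS by auto
        moreover have "iso_arcs h (Shift (i - ?t - 1) (Shift ?t a)) = Level i a"
            "iso_arcs h (Level (i - ?t) (Shift ?t a)) = Shift i a" by (simp_all add: h_simps)
        ultimately show ?thesis using e by (metis imageI)
      qed
    qed
  qed
  ultimately have "app_iso h (ZQ S) = ZQ G"
    by (simp add: app_iso_def h_simps) (simp add: ZQ_def)
  moreover have "\<forall>x \<in> verts S. iso_verts h (0, x) = x"
    by (auto simp: h_simps)
  moreover have "\<forall>a \<in> arcs S. iso_arcs h (Level 0 a) = a"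
    by (auto simp: h_simps arcs_slice)
  moreover have "\<forall>z \<in> verts (ZQ S). iso_verts h (\<tau> z) = \<tau> (iso_verts h z)"
    by (auto simp: h_simps)
  ultimately show ?thesis
    unfolding is_section_def using induced_slice iso by blast
qed

lemma slice_adjacent:
  assumes "x \<rightarrow> y"
  shows "(f x, x) \<rightarrow>\<^bsub>S\<^esub> (f y, y) \<or> (f y, y) \<rightarrow>\<^bsub>S\<^esub> (f x, x)"
proof -
  obtain a where a: "a \<in> arcs G" "tail G a = x" "head G a = y" using assms by blast
  from arrow_cases[OF a(1)] show ?thesis
  proof
    assume "f (tail G a) = f (head G a)"
    then have "Level (f x) a \<in> arcs S" "tail S (Level (f x) a) = (f x, x)" "head S (Level (f x) a) = (f y, y)"
      using a by (auto simp: arcs_slice tail_slice head_slice)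
    then show ?thesis using S.in_arcs_imp_in_arcs_ends by metis
  next
    assume "f (tail G a) = f (head G a) + 1"
    then have "Shift (f y) a \<in> arcs S" "tail S (Shift (f y) a) = (f y, y)" "head S (Shift (f y) a) = (f x, x)"
      using a by (auto simp: arcs_slice tail_slice head_slice)
    then show ?thesis using S.in_arcs_imp_in_arcs_ends by metis
  qed
qed

lemma slice_connected:
  assumes "connected G"
  shows "connected S"
  unfolding connected_def
proof
  show "verts (mk_symmetric S) \<noteq> {}"
    using assms by (auto simp: connected_def strongly_connected_def verts_slice)
  fix u v assume "u \<in> verts (mk_symmetric S)" "v \<in> verts (mk_symmetric S)"
  then obtain x y where u: "u = (f x, x)" "x \<in> verts G" and v: "v = (f y, y)" "y \<in> verts G"
    by (auto simp: verts_slice)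
  interpret M: pair_wf_digraph "mk_symmetric S" by (rule S.wellformed_mk_symmetric)
  have "x \<rightarrow>\<^sup>*\<^bsub>mk_symmetric G\<^esub> y"
    using assms u v by (auto simp: connected_def strongly_connected_def)
  then have "(x, y) \<in> (parcs (mk_symmetric G))\<^sup>*"
    by (auto dest: reachable_rtranclI)
  then have "((f x, x), (f y, y)) \<in> (parcs (mk_symmetric S))\<^sup>*"
  proof (induction rule: rtrancl_induct)
    case base
    show ?case by simp
  next
    case (step y z)
    from step(2) have "y \<rightarrow> z \<or> z \<rightarrow> y" by (auto simp: parcs_mk_symmetric arcs_ends_conv)
    then have "(f y, y) \<rightarrow>\<^bsub>S\<^esub> (f z, z) \<or> (f z, z) \<rightarrow>\<^bsub>S\<^esub> (f y, y)"
      using slice_adjacent by blast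
    then have "((f y, y), (f z, z)) \<in> parcs (mk_symmetric S)"
      by (auto simp: parcs_mk_symmetric arcs_ends_conv)
    with step.IH show ?case by (rule rtrancl_into_rtrancl)
  qed
  then show "u \<rightarrow>\<^sup>*\<^bsub>mk_symmetric S\<^esub> v"
    using u v M.reachable_conv' by (simp add: verts_slice)
qed

lemma slice_locally_finite:
  assumes "locally_finite G"
  shows "locally_finite S"
  unfolding locally_finite_def
proof
  fix u assume "u \<in> verts S"
  then obtain x where x: "u = (f x, x)" "x \<in> verts G" by (auto simp: verts_slice)
  have "{v. u \<rightarrow>\<^bsub>S\<^esub> v \<or> v \<rightarrow>\<^bsub>S\<^esub> u} \<subseteq> (\<lambda>y. (f y, y)) ` {y. x \<rightarrow> y \<or> y \<rightarrow> x}"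
  proof
    fix v assume v: "v \<in> {v. u \<rightarrow>\<^bsub>S\<^esub> v \<or> v \<rightarrow>\<^bsub>S\<^esub> u}"
    then have "v \<in> verts S" using S.adj_in_verts by blast
    then obtain y where "v = (f y, y)" by (auto simp: verts_slice)
    moreover have "u \<rightarrow>\<^bsub>ZQ G\<^esub> v \<or> v \<rightarrow>\<^bsub>ZQ G\<^esub> u" using v slice_dominates_imp by blast
    ultimately show "v \<in> (\<lambda>y. (f y, y)) ` {y. x \<rightarrow> y \<or> y \<rightarrow> x}" using x by auto
  qed
  moreover have "finite {y. x \<rightarrow> y \<or> y \<rightarrow> x}"
    using assms x(2) unfolding locally_finite_def by blast
  ultimately show "finite {v. u \<rightarrow>\<^bsub>S\<^esub> v \<or> v \<rightarrow>\<^bsub>S\<^esub> u}"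
    by (meson finite_imageI finite_subset)
qed

end


section \<open>The section half way between predecessors and successors\<close>

text \<open>
  The least number of backward steps on an unoriented path from \<open>x\<close> to \<open>y\<close>. In a connected
  quiver, the round trip distance is the sum of its values in both directions.
\<close>

definition backward_distance :: "('v, 'e) pre_digraph \<Rightarrow> 'v \<Rightarrow> 'v \<Rightarrow> nat" where
  "backward_distance Q x y = (LEAST n. (0, x) \<rightarrow>\<^sup>*\<^bsub>ZQ Q\<^esub> (int n, y))"

text \<open>
  Seen from \<open>(0, x)\<close>, the copies of \<open>y\<close> at levels from \<open>backward_distance Q x y\<close> on are successors,
  and those at levels up to \<open>- backward_distance Q y x\<close> are predecessors. Each of these two
  boundaries is a section, but the first need not exclude infinite paths to the right, nor the
  second infinite paths to the left. The middle between them stays away from both, at a distance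
  that grows with the round trip distance.
\<close>

definition middle_level :: "('v, 'e) pre_digraph \<Rightarrow> 'v \<Rightarrow> 'v \<Rightarrow> int" where
  "middle_level Q x y = (int (backward_distance Q x y) - int (backward_distance Q y x)) div 2"

lemma no_infinite_path_in_finite_acyclic:
  assumes "finite A" "range a \<subseteq> A" "acyclic r"
    and path: "(\<forall>i::nat. (a i, a (Suc i)) \<in> r) \<or> (\<forall>i::nat. (a (Suc i), a i) \<in> r)"
  shows False
proof -
  let ?r = "r \<inter> A \<times> A"
  have "finite ?r" using assms(1) by simp
  moreover have "acyclic ?r" using assms(3) by (rule acyclic_subset) simp
  ultimately have "wf ?r" "wf (?r\<inverse>)"
    by (auto intro: finite_acyclic_wf finite_acyclic_wf_converse)
  then have "\<not> (\<forall>i. (a (Suc i), a i) \<in> ?r)" "\<not> (\<forall>i. (a i, a (Suc i)) \<in> ?r)"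
    unfolding wf_iff_no_infinite_down_chain by blast+
  moreover have "a i \<in> A" for i using assms(2) by blast
  ultimately show False using path by blast
qed

locale connected_quiver = wf_digraph +
  assumes connected: "connected G"
begin

sublocale Z: wf_digraph "ZQ G"
  by (rule wf_digraph_ZQ) (rule wf_digraph)

abbreviation "bd \<equiv> backward_distance G"

lemma backward_distance_le:
  assumes "(i, x) \<rightarrow>\<^sup>*\<^bsub>ZQ G\<^esub> (j, y)"
  shows "int (bd x y) \<le> j - i"
proof -
  obtain n where n: "j = i + int n" using reachable_ZQ_level[OF assms] by (metis zle_iff_zadd)
  then have "(0, x) \<rightarrow>\<^sup>*\<^bsub>ZQ G\<^esub> (int n, y)" using reachable_ZQ_shift[OF assms, of "- i"] by simp
  then have "bd x y \<le> n" unfolding backward_distance_def by (rule Least_le)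
  with n show ?thesis by simp
qed

lemma reachable_backward_distance:
  assumes "x \<in> verts G" "y \<in> verts G"
  shows "(i, x) \<rightarrow>\<^sup>*\<^bsub>ZQ G\<^esub> (i + int (bd x y), y)"
proof -
  have "\<exists>n. (0, x) \<rightarrow>\<^sup>*\<^bsub>ZQ G\<^esub> (int n, y)"
    using connected_imp_reachable_ZQ[OF connected assms, of 0] by simp
  then have "(0, x) \<rightarrow>\<^sup>*\<^bsub>ZQ G\<^esub> (int (bd x y), y)"
    unfolding backward_distance_def by (rule LeastI_ex)
  from reachable_ZQ_shift[OF this, of i] show ?thesis by (simp add: add.commute)
qed

text \<open>
  Triangle inequalities, as a path from level \<open>i\<close> to level \<open>j\<close> costs \<open>j - i\<close> backward steps.
\<close>

lemma backward_distance_along_path: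
  assumes "x \<in> verts G" "(i, y) \<rightarrow>\<^sup>*\<^bsub>ZQ G\<^esub> (j, z)"
  shows "int (bd x z) \<le> int (bd x y) + (j - i)" "int (bd y x) \<le> int (bd z x) + (j - i)"
proof -
  have V: "y \<in> verts G" "z \<in> verts G" using Z.reachable_in_verts[OF assms(2)] by auto
  have "(i - int (bd x y), x) \<rightarrow>\<^sup>*\<^bsub>ZQ G\<^esub> (i, y)"
    using reachable_backward_distance[OF assms(1) V(1), of "i - int (bd x y)"] by simp
  from backward_distance_le[OF Z.reachable_trans[OF this assms(2)]]
  show "int (bd x z) \<le> int (bd x y) + (j - i)" by simp
  from backward_distance_le[OF Z.reachable_trans[OF assms(2) reachable_backward_distance[OF V(2) assms(1)]]]
  show "int (bd y x) \<le> int (bd z x) + (j - i)" by simp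
qed

text \<open>
  Along an arrow both boundary levels drop by zero or one, so their sum drops by at most two and its
  half, rounded down, by at most one.
\<close>

lemma slice_function_middle_level:
  assumes "x \<in> verts G"
  shows "slice_function G (middle_level G x)"
proof unfold_locales
  fix y z assume "y \<rightarrow> z"
  then have "(0, y) \<rightarrow>\<^sup>*\<^bsub>ZQ G\<^esub> (0, z)" "(0, z) \<rightarrow>\<^sup>*\<^bsub>ZQ G\<^esub> (1, y)"
    by auto
  note d = this[THEN backward_distance_along_path(1)[OF assms]]
    this[THEN backward_distance_along_path(2)[OF assms]]
  show "middle_level G x z \<le> middle_level G x y"
    unfolding middle_level_def using d by linarith
  show "middle_level G x y \<le> middle_level G x z + 1"
    unfolding middle_level_def using d by linarith
qed

lemma finite_round_trip_ball:
  assumes "x \<in> verts G" and fin: "\<And>n::nat. finite (paths (ZQ G) (0, x) (int n, x))"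
  shows "finite {y \<in> verts G. bd x y + bd y x \<le> N}"
proof -
  have "{y \<in> verts G. bd x y + bd y x \<le> N} \<subseteq>
      (\<Union>n \<in> {..N}. \<Union>q \<in> paths (ZQ G) (0, x) (int n, x). snd ` set q)"
  proof safe
    fix y assume y: "y \<in> verts G" "bd x y + bd y x \<le> N"
    have "(0, x) \<rightarrow>\<^sup>*\<^bsub>ZQ G\<^esub> (int (bd x y), y)"
      using reachable_backward_distance[OF assms(1) y(1), of 0] by simp
    moreover have "(int (bd x y), y) \<rightarrow>\<^sup>*\<^bsub>ZQ G\<^esub> (int (bd x y + bd y x), x)"
      using reachable_backward_distance[OF y(1) assms(1), of "int (bd x y)"] by simp
    ultimately obtain q where "q \<in> paths (ZQ G) (0, x) (int (bd x y + bd y x), x)"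
        "(int (bd x y), y) \<in> set q"
      using Z.path_through by blast
    moreover from this have "y \<in> snd ` set q" by force
    ultimately show "y \<in> (\<Union>n \<in> {..N}. \<Union>q \<in> paths (ZQ G) (0, x) (int n, x). snd ` set q)"
      using y(2) by blast
  qed
  moreover have "finite (\<Union>n \<in> {..N}. \<Union>q \<in> paths (ZQ G) (0, x) (int n, x). snd ` set q)"
    using fin by blast
  ultimately show ?thesis by (rule finite_subset)
qed

text \<open>
  Along a path of the middle section starting at \<open>a 0\<close>, the gap between the level and the boundary
  of the successors of \<open>(0, x)\<close> does not grow, by the triangle inequality. As this gap is half the
  round trip distance from \<open>x\<close>, rounded up, the path stays in a finite ball. An infinite path would
  then have to repeat a vertex. Infinite paths ending in \<open>a 0\<close> are treated in the same way with the
  boundary of the predecessors.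
\<close>

lemma middle_slice_path_finite:
  assumes x: "x \<in> verts G"
    and fin: "\<And>u v. \<lbrakk>u \<in> verts (ZQ G); v \<in> verts (ZQ G)\<rbrakk> \<Longrightarrow> finite (paths (ZQ G) u v)"
  shows "path_finite (graph_slice G (middle_level G x))"
proof -
  let ?f = "middle_level G x"
  interpret slice_function G ?f by (rule slice_function_middle_level[OF x])
  have acyc: "acyclic (arcs_ends (ZQ G))"
    using fin Z.finite_paths_imp_no_cycle Z.reachable1_in_verts unfolding acyclic_def by metis
  have bounded: False
    if ar: "(\<forall>i. a i \<rightarrow>\<^bsub>S\<^esub> a (Suc i)) \<or> (\<forall>i. a (Suc i) \<rightarrow>\<^bsub>S\<^esub> a i)"
      and le: "\<And>i. int (bd x (snd (a i)) + bd (snd (a i)) x) \<le> C" for a :: "nat \<Rightarrow> int \<times> 'a" and C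
  proof -
    \<comment> \<open>Whichever direction the infinite path has, a bound on the round trip distances is contradictory.\<close>
    let ?B = "{y \<in> verts G. bd x y + bd y x \<le> nat C}"
    have "a i \<in> verts S" for i using ar S.adj_in_verts by blast
    then have "a i \<in> (\<lambda>y. (?f y, y)) ` ?B" for i
      using le[of i] by (force simp: verts_slice)
    then have ran: "range a \<subseteq> (\<lambda>y. (?f y, y)) ` ?B" by blast
    have fin_range: "finite ((\<lambda>y. (?f y, y)) ` ?B)"
      using finite_round_trip_ball[OF x] fin x by simp
    have "(\<forall>i. a i \<rightarrow>\<^bsub>ZQ G\<^esub> a (Suc i)) \<or> (\<forall>i. a (Suc i) \<rightarrow>\<^bsub>ZQ G\<^esub> a i)"
      using ar slice_dominates_imp by blast
    from no_infinite_path_in_finite_acyclic[OF fin_range ran acyc this] show False .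
  qed
  \<comment> \<open>The gap to the successor boundary is at least half the round trip distance; the gap to the
    predecessor boundary may be less by one half, as the level is rounded down.\<close>
  have div2: "a + b \<le> 2 * (a - (a - b) div 2)" "a + b \<le> 2 * (b + (a - b) div 2) + 1" for a b :: int
    by presburger+
  have half1: "int (bd x y) + int (bd y x) \<le> 2 * (int (bd x y) - ?f y)" for y
    unfolding middle_level_def by (rule div2)
  have half2: "int (bd x y) + int (bd y x) \<le> 2 * (int (bd y x) + ?f y) + 1" for y
    unfolding middle_level_def by (rule div2)
  show ?thesis
    unfolding path_finite_def
  proof (intro conjI notI)
    assume "\<exists>a. \<forall>i. a i \<rightarrow>\<^bsub>S\<^esub> a (Suc i)"
    then obtain a where a: "\<And>i. a i \<rightarrow>\<^bsub>S\<^esub> a (Suc i)" by blast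
    then have level: "a i = (?f (snd (a i)), snd (a i))" for i
      using S.adj_in_verts slice_vertex by blast
    have reach: "a 0 \<rightarrow>\<^sup>*\<^bsub>ZQ G\<^esub> a i" for i
    proof (induction i)
      case 0
      show ?case using a[of 0] slice_dominates_imp Z.adj_in_verts by blast
    next
      case (Suc i)
      then show ?case using a[of i] slice_dominates_imp Z.reachable_adj_trans by blast
    qed
    let ?C = "2 * (int (bd x (snd (a 0))) - ?f (snd (a 0)))"
    have "int (bd x (snd (a i)) + bd (snd (a i)) x) \<le> ?C" for i
      using backward_distance_along_path(1)[OF x, of "?f (snd (a 0))" "snd (a 0)" "?f (snd (a i))" "snd (a i)"]
        reach[of i] level[of 0] level[of i] half1[of "snd (a i)"] by simp
    with bounded a show False by blast
  next
    assume "\<exists>a. \<forall>i. a (Suc i) \<rightarrow>\<^bsub>S\<^esub> a i"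
    then obtain a where a: "\<And>i. a (Suc i) \<rightarrow>\<^bsub>S\<^esub> a i" by blast
    then have level: "a i = (?f (snd (a i)), snd (a i))" for i
      using S.adj_in_verts slice_vertex by blast
    have reach: "a i \<rightarrow>\<^sup>*\<^bsub>ZQ G\<^esub> a 0" for i
    proof (induction i)
      case 0
      show ?case using a[of 0] slice_dominates_imp Z.adj_in_verts by blast
    next
      case (Suc i)
      then show ?case using a[of i] slice_dominates_imp Z.adj_reachable_trans by blast
    qed
    let ?C = "2 * (int (bd (snd (a 0)) x) + ?f (snd (a 0))) + 1"
    have "int (bd x (snd (a i)) + bd (snd (a i)) x) \<le> ?C" for i
      using backward_distance_along_path(2)[OF x, of "?f (snd (a i))" "snd (a i)" "?f (snd (a 0))" "snd (a 0)"]
        reach[of i] level[of 0] level[of i] half2[of "snd (a i)"] by simp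
    with bounded a show False by blast
  qed
qed

lemma finite_paths_imp_section:
  assumes fin: "\<And>u v. \<lbrakk>u \<in> verts (ZQ G); v \<in> verts (ZQ G)\<rbrakk> \<Longrightarrow> finite (paths (ZQ G) u v)"
  shows "\<exists>S. is_section S G \<and> strongly_locally_finite S"
proof -
  obtain x where x: "x \<in> verts G"
    using connected by (auto simp: connected_def strongly_connected_def)
  interpret slice_function G "middle_level G x" by (rule slice_function_middle_level[OF x])
  have "strongly_locally_finite S"
    using slice_connected[OF connected] slice_locally_finite[OF finite_paths_imp_locally_finite[OF fin]]
      middle_slice_path_finite[OF x fin]
    by (simp add: strongly_locally_finite_def)
  with slice_is_section show ?thesis by blast
qed

end


section \<open>The equivalences\<close>

theorem theorem4p4:
  fixes Q :: "('v, 'e) pre_digraph"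
  assumes "wf_digraph Q" and "connected Q"
  shows "let
      S1 = (locally_finite Q \<and>
            (\<forall>x \<in> verts (ZQ Q). \<forall>y \<in> verts (ZQ Q). finite (sectional_paths Q x y)));
      S2 = (\<forall>x \<in> verts (ZQ Q). \<forall>y \<in> verts (ZQ Q). finite (paths (ZQ Q) x y));
      S3 = (\<forall>x \<in> verts (ZQ Q). \<forall>n::nat. finite (paths (ZQ Q) x ((inv \<tau> ^^ n) x)));
      S4 = (\<exists>x \<in> verts (ZQ Q). \<forall>n::nat. finite (paths (ZQ Q) x ((inv \<tau> ^^ n) x)));
      S5 = ((\<nexists>p. oriented_cycle Q p) \<and>
            (\<forall>x \<in> verts Q. \<forall>n. finite (round_trip_sphere Q x n)));
      S6 = ((\<nexists>p. oriented_cycle Q p) \<and>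
            (\<exists>x \<in> verts Q. \<forall>n. finite (round_trip_sphere Q x n)));
      S7 = (\<exists>S. is_section S Q \<and> strongly_locally_finite S)
    in (S1 \<longleftrightarrow> S2) \<and> (S2 \<longleftrightarrow> S3) \<and> (S3 \<longleftrightarrow> S4) \<and> (S4 \<longleftrightarrow> S5) \<and> (S5 \<longleftrightarrow> S6) \<and> (S6 \<longleftrightarrow> S7)"
proof -
  interpret connected_quiver Q
    using assms by (simp add: connected_quiver_def connected_quiver_axioms_def)
  define S1 where "S1 \<longleftrightarrow> locally_finite Q \<and>
    (\<forall>x \<in> verts (ZQ Q). \<forall>y \<in> verts (ZQ Q). finite (sectional_paths Q x y))"
  define S2 where "S2 \<longleftrightarrow> (\<forall>x \<in> verts (ZQ Q). \<forall>y \<in> verts (ZQ Q). finite (paths (ZQ Q) x y))"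
  define S3 where "S3 \<longleftrightarrow> (\<forall>x \<in> verts (ZQ Q). \<forall>n::nat. finite (paths (ZQ Q) x ((inv \<tau> ^^ n) x)))"
  define S4 where "S4 \<longleftrightarrow> (\<exists>x \<in> verts (ZQ Q). \<forall>n::nat. finite (paths (ZQ Q) x ((inv \<tau> ^^ n) x)))"
  define S5 where "S5 \<longleftrightarrow> (\<nexists>p. oriented_cycle Q p) \<and>
    (\<forall>x \<in> verts Q. \<forall>n. finite (round_trip_sphere Q x n))"
  define S6 where "S6 \<longleftrightarrow> (\<nexists>p. oriented_cycle Q p) \<and>
    (\<exists>x \<in> verts Q. \<forall>n. finite (round_trip_sphere Q x n))"
  define S7 where "S7 \<longleftrightarrow> (\<exists>S. is_section S Q \<and> strongly_locally_finite S)"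
  have nonempty: "verts Q \<noteq> {}"
    using connected by (auto simp: connected_def strongly_connected_def)
  have 12: "S1 \<Longrightarrow> S2"
    using finite_sectional_paths_imp_finite_paths unfolding S1_def S2_def by blast
  have 21: "S2 \<Longrightarrow> S1"
    using finite_paths_imp_locally_finite unfolding S1_def S2_def sectional_paths_def
    by (metis (no_types, lifting) finite_subset mem_Collect_eq subsetI)
  have 23: "S2 \<Longrightarrow> S3"
    unfolding S2_def S3_def by (auto simp: inv_\<tau>_power)
  have 34: "S3 \<Longrightarrow> S4"
    using nonempty unfolding S3_def S4_def by auto
  have 42: "S4 \<Longrightarrow> S2"
  proof -
    assume S4
    then obtain i x where "(i, x) \<in> verts (ZQ Q)"
        "\<And>n::nat. finite (paths (ZQ Q) (i, x) ((inv \<tau> ^^ n) (i, x)))"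
      unfolding S4_def by auto
    then show S2
      using finite_paths_ZQ_of_base[OF connected] unfolding S2_def inv_\<tau>_power by blast
  qed
  have 25: "S2 \<Longrightarrow> S5"
  proof -
    assume S2
    then have fin: "finite (paths (ZQ Q) u v)" if "u \<in> verts (ZQ Q)" "v \<in> verts (ZQ Q)" for u v
      using that unfolding S2_def by blast
    then have "\<not> u \<rightarrow>\<^sup>+\<^bsub>ZQ Q\<^esub> u" for u
      using Z.finite_paths_imp_no_cycle Z.reachable1_in_verts by metis
    then have "\<nexists>p. oriented_cycle Q p"
      using ZQ_acyclic_iff no_oriented_cycle_iff by blast
    moreover have "finite (round_trip_sphere Q x n)" if "x \<in> verts Q" for x n
      using finite_paths_imp_finite_sphere[OF connected that, of 0 n] fin that by simp
    ultimately show S5 unfolding S5_def by blast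
  qed
  have 56: "S5 \<Longrightarrow> S6"
    using nonempty unfolding S5_def S6_def by blast
  have 64: "S6 \<Longrightarrow> S4"
  proof -
    assume S6
    then obtain x where "x \<in> verts Q" "\<nexists>p. oriented_cycle Q p" "\<And>n. finite (round_trip_sphere Q x n)"
      unfolding S6_def by blast
    then have "(0, x) \<in> verts (ZQ Q)" "finite (paths (ZQ Q) (0, x) ((inv \<tau> ^^ n) (0, x)))" for n
      using finite_spheres_imp_finite_paths[of x 0 n] by (simp_all add: inv_\<tau>_power)
    then show S4 unfolding S4_def by blast
  qed
  have 27: "S2 \<Longrightarrow> S7"
    using finite_paths_imp_section unfolding S2_def S7_def by blast
  have 72: "S7 \<Longrightarrow> S2"
    using finite_paths_ZQ_of_section unfolding S2_def S7_def by blast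
  have "(S1 \<longleftrightarrow> S2) \<and> (S2 \<longleftrightarrow> S3) \<and> (S3 \<longleftrightarrow> S4) \<and> (S4 \<longleftrightarrow> S5) \<and> (S5 \<longleftrightarrow> S6) \<and> (S6 \<longleftrightarrow> S7)"
    using 12 21 23 34 42 25 56 64 27 72 by blast
  then show ?thesis
    unfolding Let_def S1_def S2_def S3_def S4_def S5_def S6_def S7_def .
qed

end
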